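(* Given a normalized signal $g:V\to\mathbb{R}$ (i.e. $\|g\|_2=1$), feature locations $f,h:V\to\mathbb{R}$, and a phase $\theta\in\mathbb{R}$, the expected momentum of $D[\theta h]g$ satisfies $$\mathcal{E}_{i\nabla_f}(D[\theta h]g)=\sum_{(m,n)\in E}a_{m,n}\,g(m)\,g(n)\,(f(n)-f(m))\,\sin\big(\theta(h(n)-h(m))\big),$$ where the sum is over ordered pairs $(m,n)\in E$.
   Context: $\mathcal{G}=(V,E)$ is a finite undirected weighted graph with $V=[N]=\{1,\dots,N\}$. The edge set $E\subset[N]^2$ is a symmetric set of ordered pairs (each undirected edge between distinct nodes contributes both orientations). The adjacency matrix $A=(a_{n,m})\in\mathbb{R}^{N\times N}$ is real symmetric, with $a_{n,m}=0$ whenever $(n,m)\notin E$. Signals are identified with vectors in $\mathbb{C}^N$, with $\langle u,g\rangle=\sum_{v\in V}u(v)\overline{g(v)}$ and $\|g\|_2^2=\langle g,g\rangle$. A feature location is a function $V\to\mathbb{R}$. The $f$-partial derivative is the matrix $\nabla_f\in\mathbb{C}^{N\times N}$ with entries $(\nabla_f)_{n,m}=a_{n,m}(f(n)-f(m))$; $i\nabla_f$ is self-adjoint and is called the momentum observable. The feature modulation operator is $D[\theta h]=\mathrm{diag}(e^{i\theta h})$, i.e. $(D[\theta h]g)(v)=e^{i\theta h(v)}g(v)$. For a self-adjoint operator $M$ and a normalized signal $g$, $\mathcal{E}_M(g)=\langle Mg,g\rangle$. *)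

theory Defs
  imports "HOL-Analysis.Analysis"
begin

text \<open>
  The vertex set is an arbitrary finite type \<open>'n\<close>, so \<open>N = CARD('n)\<close>. Edges are ordered pairs,
  and an edge set is symmetric; loops are not excluded.
\<close>

locale weighted_graph =
  fixes E :: "('n::finite \<times> 'n) set"
    and A :: "real ^ 'n ^ 'n"
  assumes sym_edges: "sym E"
    and sym_adjacency: "transpose A = A"
    and no_edge: "(n, m) \<notin> E \<Longrightarrow> A $ n $ m = 0"

text \<open>
  The library's \<open>inner\<close> on \<^typ>\<open>complex ^ 'n\<close> is the real inner product, hence the
  following definition. The library's \<open>norm\<close> is the one this product induces (see
  \<open>hinner_self\<close>).
\<close>

definition hinner :: "complex ^ 'n::finite \<Rightarrow> complex ^ 'n \<Rightarrow> complex" where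
  "hinner u g = (\<Sum>v\<in>UNIV. u $ v * cnj (g $ v))"

definition adjoint_matrix :: "complex ^ 'n ^ 'm \<Rightarrow> complex ^ 'm ^ 'n" where
  "adjoint_matrix M = (\<chi> n m. cnj (M $ m $ n))"

definition self_adjoint :: "complex ^ 'n ^ 'n \<Rightarrow> bool" where
  "self_adjoint M \<longleftrightarrow> adjoint_matrix M = M"

definition expected_value :: "complex ^ 'n ^ 'n::finite \<Rightarrow> complex ^ 'n \<Rightarrow> complex" where
  "expected_value M g = hinner (M *v g) g"

definition real_signal :: "('n \<Rightarrow> real) \<Rightarrow> complex ^ 'n" where
  "real_signal g = (\<chi> v. complex_of_real (g v))"

definition partial_derivative :: "real ^ 'n ^ 'n \<Rightarrow> ('n \<Rightarrow> real) \<Rightarrow> complex ^ 'n ^ 'n" where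
  "partial_derivative A f = (\<chi> n m. complex_of_real (A $ n $ m * (f n - f m)))"

definition momentum :: "real ^ 'n ^ 'n \<Rightarrow> ('n \<Rightarrow> real) \<Rightarrow> complex ^ 'n ^ 'n" where
  "momentum A f = (\<chi> n m. \<i> * partial_derivative A f $ n $ m)"

definition diag_matrix :: "('n \<Rightarrow> complex) \<Rightarrow> complex ^ 'n ^ 'n" where
  "diag_matrix d = (\<chi> n m. if n = m then d n else 0)"

definition modulation :: "('n \<Rightarrow> real) \<Rightarrow> complex ^ 'n ^ 'n" where
  "modulation q = diag_matrix (\<lambda>v. exp (\<i> * complex_of_real (q v)))"

lemma hinner_self: "hinner g g = complex_of_real ((norm g)\<^sup>2)"
  by (simp add: hinner_def norm_vec_def L2_set_def sum_nonneg flip: complex_norm_square)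

lemma modulation_apply:
  "(modulation q *v g) $ v = exp (\<i> * complex_of_real (q v)) * g $ v"
  by (simp add: modulation_def diag_matrix_def matrix_vector_mult_def
      if_distrib [of "\<lambda>x. x * _"] cong: if_cong)

lemma (in weighted_graph) self_adjoint_momentum: "self_adjoint (momentum A f)"
proof -
  have "A $ n $ m = A $ m $ n" for n m
    using sym_adjacency by (metis transpose_def vec_lambda_beta)
  then show ?thesis
    by (simp add: self_adjoint_def adjoint_matrix_def momentum_def partial_derivative_def
        vec_eq_iff algebra_simps)
qed

end

theory Submission imports Defs begin

text \<open>
  Conjugating the momentum by the modulation multiplies its \<open>(n, m)\<close> entry by \<open>cis (- x)\<close> with
  \<open>x = \<theta> (h n - h m)\<close>, and \<open>\<i> cis (- x) = sin x + \<i> cos x\<close>. The adjacency matrix being symmetric,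
  the sine terms are symmetric in \<open>n\<close>, \<open>m\<close> and the cosine terms antisymmetric, so the latter cancel.
\<close>

text \<open>Exchanging the two summations turns the sum into its own negative.\<close>

lemma sum_antisym_eq_0:
  fixes F :: "'n \<Rightarrow> 'n \<Rightarrow> real"
  assumes "\<And>n m. F n m = - F m n"
  shows "(\<Sum>n\<in>S. \<Sum>m\<in>S. F n m) = 0"
proof -
  have "(\<Sum>n\<in>S. \<Sum>m\<in>S. F n m) = (\<Sum>n\<in>S. \<Sum>m\<in>S. - F m n)"
    using assms by (intro sum.cong refl)
  also have "\<dots> = - (\<Sum>n\<in>S. \<Sum>m\<in>S. F m n)"
    by (simp add: sum_negf)
  also have "(\<Sum>n\<in>S. \<Sum>m\<in>S. F m n) = (\<Sum>n\<in>S. \<Sum>m\<in>S. F n m)"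
    by (rule sum.swap)
  finally show ?thesis by simp
qed

text \<open>The matrix product supplies the phase at \<open>m\<close>, and the second argument of
  \<open>hinner\<close> supplies the conjugate phase at \<open>n\<close>; \<open>g\<close> is real,
  so conjugation leaves its values alone.\<close>

lemma expected_momentum_modulation:
  fixes A :: "real ^ 'n::finite ^ 'n"
  shows "expected_value (momentum A f) (modulation q *v real_signal g) =
    (\<Sum>n\<in>UNIV. \<Sum>m\<in>UNIV.
      \<i> * complex_of_real (A $ n $ m * (f n - f m) * g m * g n) * cis (- (q n - q m)))"
proof -
  define u where "u = modulation q *v real_signal g"
  have u: "u $ v = cis (q v) * complex_of_real (g v)" for v
    by (simp add: u_def modulation_apply real_signal_def cis_conv_exp)
  have "cis (- (q n - q m)) = cis (q m) * cnj (cis (q n))" for n m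
    by (simp add: cis_cnj cis_mult)
  then have "expected_value (momentum A f) u = (\<Sum>n\<in>UNIV. \<Sum>m\<in>UNIV.
      \<i> * complex_of_real (A $ n $ m * (f n - f m) * g m * g n) * cis (- (q n - q m)))"
    by (simp add: expected_value_def hinner_def matrix_vector_mult_def u momentum_def
        partial_derivative_def sum_distrib_left mult_ac)
  then show ?thesis by (simp only: u_def)
qed

theorem theorem10:
  fixes E :: "('n::finite \<times> 'n) set"
    and A :: "real ^ 'n ^ 'n"
    and f g h :: "'n \<Rightarrow> real"
    and \<theta> :: real
  assumes "weighted_graph E A"
    and "norm (real_signal g) = 1"
  shows "expected_value (momentum A f) (modulation (\<lambda>v. \<theta> * h v) *v real_signal g) =
    complex_of_real
      (\<Sum>(m, n)\<in>E. A $ m $ n * g m * g n * (f n - f m) * sin (\<theta> * (h n - h m)))"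
proof -
  interpret weighted_graph E A by fact
  have A_commute: "A $ n $ m = A $ m $ n" for n m
    using sym_adjacency by (metis transpose_def vec_lambda_beta)
  \<comment> \<open>\<open>c\<close> is antisymmetric: the difference of \<open>f\<close> changes
    sign under exchange of \<open>n\<close> and \<open>m\<close>, while the other factors are
    symmetric. Against the even cosine it cancels.\<close>
  define c where "c n m = A $ n $ m * (f n - f m) * g m * g n" for n m
  \<comment> \<open>\<open>F\<close> takes its indices in the order of the pairs in
    \<open>E\<close>; \<open>F m n\<close> differs from the sine term of \<open>c n m\<close> only
    by transposing the entry of \<open>A\<close>.\<close>
  define F where "F m n = A $ m $ n * g m * g n * (f n - f m) * sin (\<theta> * (h n - h m))" for m n
  let ?S = "expected_value (momentum A f) (modulation (\<lambda>v. \<theta> * h v) *v real_signal g)"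
  have S: "?S = (\<Sum>n\<in>UNIV. \<Sum>m\<in>UNIV.
      \<i> * complex_of_real (c n m) * cis (- (\<theta> * (h n - h m))))"
    by (simp add: expected_momentum_modulation c_def right_diff_distrib)
  have "Im ?S = (\<Sum>n\<in>UNIV. \<Sum>m\<in>UNIV. c n m * cos (\<theta> * (h n - h m)))"
    by (simp add: S Im_sum)
  also have "\<dots> = 0"
  proof (rule sum_antisym_eq_0)
    fix n m
    have "cos (\<theta> * (h n - h m)) = cos (\<theta> * (h m - h n))"
      by (metis cos_minus minus_diff_eq mult_minus_right)
    then show "c n m * cos (\<theta> * (h n - h m)) = - (c m n * cos (\<theta> * (h m - h n)))"
      by (simp add: c_def A_commute[of n m] algebra_simps)
  qed
  finally have Im: "Im ?S = 0" .
  have "Re ?S = (\<Sum>n\<in>UNIV. \<Sum>m\<in>UNIV. c n m * sin (\<theta> * (h n - h m)))"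
    by (simp add: S Re_sum)
  also have "\<dots> = (\<Sum>n\<in>UNIV. \<Sum>m\<in>UNIV. F m n)"
    by (intro sum.cong refl) (simp add: c_def F_def A_commute mult_ac)
  \<comment> \<open>The outer index has to become \<open>m\<close>, the first component of an edge,
    before the double sum is read as a sum over pairs.\<close>
  also have "\<dots> = (\<Sum>m\<in>UNIV. \<Sum>n\<in>UNIV. F m n)"
    by (rule sum.swap)
  also have "\<dots> = (\<Sum>(m, n)\<in>UNIV. F m n)"
    by (simp add: sum.cartesian_product)
  \<comment> \<open>Off \<open>E\<close> the entry of \<open>A\<close> vanishes, and with it the
    summand.\<close>
  also have "\<dots> = (\<Sum>(m, n)\<in>E. F m n)"
    by (rule sum.mono_neutral_right) (auto simp: F_def no_edge)
  finally have "Re ?S = (\<Sum>(m, n)\<in>E. F m n)" .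
  with Im show ?thesis
    by (simp add: complex_eq_iff F_def)
qed

end
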